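(* Let $h\geq1$ and $n\geq1$. Let $\mathcal{C}_n$ be the set of words $a_1\cdots a_n$ over the alphabet $\{1,2,\dotsc,h,\infty\}$ such that for every $i$ with $a_i\neq\infty$ we have $a_{i+1}\geq a_i+1$, where the index $i+1$ is taken cyclically modulo $n$ (so $a_{n+1}=a_1$) and $\infty$ is larger than every integer. (These encode tilings of a cylinder of circumference $n$ and height $2h-1$ by unit squares and $L$-shaped tiles of width $2$ whose left column has $h$ cells and whose right column is a single cell at the bottom.) Then the polynomial \[ \sum_{w\in\mathcal{C}_n}t^{\mathrm{bigtiles}(w)}, \] where $\mathrm{bigtiles}(w)$ is the number of letters of $w$ different from $\infty$, has only real zeros. *)

theory Defs
  imports Complex_Main "HOL-Library.Extended_Nat" "HOL-Computational_Algebra.Polynomial"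
begin

text \<open>Positions run from 0 to \<open>n - 1\<close>, so the cyclic successor of \<open>i\<close> is \<open>(i + 1) mod n\<close>;
  the order and addition on \<open>enat\<close> make \<open>\<infinity>\<close> larger than every integer.\<close>

definition cylinder_words :: "nat \<Rightarrow> nat \<Rightarrow> enat list set" where
  "cylinder_words h n =
     {w. length w = n \<and> set w \<subseteq> insert \<infinity> (enat ` {1..h}) \<and>
         (\<forall>i<n. w ! i \<noteq> \<infinity> \<longrightarrow> w ! ((i + 1) mod n) \<ge> w ! i + 1)}"

lemma finite_cylinder_words: "finite (cylinder_words h n)"
  by (rule finite_subset[OF _ finite_lists_length_eq[of "insert \<infinity> (enat ` {1..h})" n]])
     (auto simp: cylinder_words_def)

definition bigtiles :: "enat list \<Rightarrow> nat" where
  "bigtiles w = card {i. i < length w \<and> w ! i \<noteq> \<infinity>}"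

definition cylinder_poly :: "nat \<Rightarrow> nat \<Rightarrow> real poly" where
  "cylinder_poly h n = (\<Sum>w\<in>cylinder_words h n. monom 1 (bigtiles w))"

definition only_real_zeros :: "real poly \<Rightarrow> bool" where
  "only_real_zeros p \<longleftrightarrow>
     (\<forall>z::complex. poly (map_poly complex_of_real p) z = 0 \<longrightarrow> z \<in> \<real>)"

end

theory Submission
  imports Defs
begin

text \<open>Cut a cyclic word at its first letter. Summing over the words that follow a letter \<open>h - i\<close>
  turns the count into a count of tilings of a strip by unit squares and tiles of length \<open>h + 1\<close>,
  whose generating function satisfies \<open>E (k + 1) = E k + t E (k - h)\<close>, and the cylinder polynomial
  becomes \<open>E k + (h + 1) t E (k - h)\<close> with \<open>k = (n + 1) h - 1\<close>. For \<open>t\<close> in the upper half plane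
  the recurrence preserves the property that any two members \<open>E i, E j\<close> (\<open>i \<le> j\<close>) of a window of
  length \<open>h + 1\<close> satisfy \<open>0 \<le> arg (E j / E i) \<le> arg t\<close>. This forces the imaginary part of
  \<open>E k / E (k - h) + (h + 1) t\<close> to be positive, so the cylinder polynomial does not vanish at \<open>t\<close>.\<close>

section \<open>Tiling polynomials on the upper half plane\<close>

text \<open>The index is shifted by \<open>h\<close>: a strip of length \<open>l\<close> corresponds to \<open>k = l + h\<close>.\<close>

fun tilings :: "nat \<Rightarrow> 'a::comm_ring_1 \<Rightarrow> nat \<Rightarrow> 'a" where
  "tilings h t k =
     (if k < h then 0 else if k = h then 1 else tilings h t (k - 1) + t * tilings h t (k - 1 - h))"

declare tilings.simps [simp del]

lemma tilings_less [simp]: "k < h \<Longrightarrow> tilings h t k = 0"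
  by (simp add: tilings.simps)

lemma tilings_same [simp]: "tilings h t h = 1"
  by (simp add: tilings.simps)

lemma tilings_Suc: "h \<le> k \<Longrightarrow> tilings h t (Suc k) = tilings h t k + t * tilings h t (k - h)"
  by (subst tilings.simps) simp

text \<open>A strip of length at most \<open>h\<close> has no room for a tile of length
  \<open>h + 1\<close>.\<close>

lemma tilings_eq_1: "h \<le> k \<Longrightarrow> k \<le> 2 * h \<Longrightarrow> tilings h t k = 1"
  by (induction k rule: dec_induct) (simp_all add: tilings_Suc)

text \<open>For \<open>v, w \<noteq> 0\<close> and \<open>Im z > 0\<close> this says \<open>0 \<le> arg (w / v) \<le> arg z\<close>.\<close>

definition arg_between :: "complex \<Rightarrow> complex \<Rightarrow> complex \<Rightarrow> bool" where
  "arg_between z v w \<longleftrightarrow> 0 \<le> Im (w * cnj v) \<and> 0 \<le> Im (z * v * cnj w)"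

lemma arg_between_refl: "0 \<le> Im z \<Longrightarrow> arg_between z v v"
  by (simp add: arg_between_def mult.assoc flip: complex_norm_square of_real_power)

text \<open>As arg (z u / v) = arg z - arg (v / u), the sector condition on \<open>u\<close>,
  \<open>v\<close> passes to \<open>v\<close>, \<open>z * u\<close>; it is additive in its last
  argument.\<close>

lemma arg_between_add_mult:
  assumes "arg_between z u v" "arg_between z v w"
  shows "arg_between z v (w + z * u)"
proof -
  have "z * v * cnj (w + z * u) = z * v * cnj w + of_real ((cmod z)\<^sup>2) * (v * cnj u)"
    unfolding complex_norm_square by (simp add: algebra_simps)
  then have "Im (z * v * cnj (w + z * u)) = Im (z * v * cnj w) + (cmod z)\<^sup>2 * Im (v * cnj u)"
    by (simp only: plus_complex.sel Im_complex_of_real Re_complex_of_real times_complex.sel)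
  moreover have "Im ((w + z * u) * cnj v) = Im (w * cnj v) + Im (z * u * cnj v)"
    by (simp add: algebra_simps)
  ultimately show ?thesis
    using assms unfolding arg_between_def by (metis add_nonneg_nonneg mult_nonneg_nonneg zero_le_power2)
qed

lemma tilings_arg_between:
  assumes "0 \<le> Im z" "i \<le> j" "j \<le> i + h"
  shows "arg_between z (tilings h z i) (tilings h z j)"
  using assms(2,3)
proof (induction j arbitrary: i rule: less_induct)
  case (less j)
  consider "i = j" | "i < j" "j \<le> h" | l where "j = Suc l" "i \<le> l" "h \<le> l"
    using less.prems by (cases j) fastforce+
  then show ?case
  proof cases
    case 1
    then show ?thesis using assms(1) by (simp add: arg_between_refl)
  next
    case 2
    then show ?thesis by (simp add: arg_between_def)
  next
    \<comment> \<open>Since \<open>l - h \<le> i \<le> l\<close>, both pairs lie in windows whose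
      upper end is below \<open>j\<close>.\<close>
    case 3
    then have "arg_between z (tilings h z (l - h)) (tilings h z i)"
      and "arg_between z (tilings h z i) (tilings h z l)"
      using less.IH less.prems by simp_all
    then show ?thesis using 3 by (simp add: tilings_Suc arg_between_add_mult)
  qed
qed

text \<open>After multiplication by the conjugate of a nonzero \<open>tilings h z (k - h)\<close>,
  the first term has nonnegative and the second positive imaginary part. \<open>c = 1\<close> serves
  the recurrence, \<open>c = h + 1\<close> the cylinder polynomial.\<close>

lemma tilings_add_mult_nonzero:
  assumes "0 < Im z" "0 < c" "h \<le> k" "tilings h z k \<noteq> 0"
  shows "tilings h z k + of_real c * z * tilings h z (k - h) \<noteq> 0"
proof (cases "tilings h z (k - h) = 0")
  case False
  let ?u = "tilings h z (k - h)" and ?v = "tilings h z k"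
  have "Im ((?v + of_real c * z * ?u) * cnj ?u) = Im (?v * cnj ?u) + c * (cmod ?u)\<^sup>2 * Im z"
    unfolding cmod_power2 by (simp add: algebra_simps power2_eq_square)
  moreover have "0 \<le> Im (?v * cnj ?u)"
    using tilings_arg_between[of z "k - h" k h] assms by (simp add: arg_between_def)
  moreover have "0 < c * (cmod ?u)\<^sup>2 * Im z"
    using assms False by simp
  ultimately have "0 < Im ((?v + of_real c * z * ?u) * cnj ?u)"
    by linarith
  then show ?thesis
    by (metis less_irrefl mult_zero_left zero_complex.sel(2))
qed (use assms in simp)

lemma tilings_nonzero:
  assumes "0 < Im z" "h \<le> k"
  shows "tilings h z k \<noteq> 0"
  using assms(2)
proof (induction k rule: dec_induct)
  case (step k)
  then show ?case
    using tilings_add_mult_nonzero[of z 1 h k] assms(1) by (simp add: tilings_Suc)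
qed simp

section \<open>Words between two fixed letters\<close>

abbreviation (input) cylinder_letters :: "nat \<Rightarrow> enat set" where
  "cylinder_letters h \<equiv> insert \<infinity> (enat ` {1..h})"

definition may_precede :: "enat \<Rightarrow> enat \<Rightarrow> bool" where
  "may_precede a b \<longleftrightarrow> (a \<noteq> \<infinity> \<longrightarrow> a + 1 \<le> b)"

text \<open>\<open>a\<close> and \<open>b\<close> lie outside the word; for \<open>a = b\<close>
  they stand for the letter at which a cyclic word is cut.\<close>

definition strip_words :: "nat \<Rightarrow> enat \<Rightarrow> nat \<Rightarrow> enat \<Rightarrow> enat list set" where
  "strip_words h a m b =
     {w. length w = m \<and> set w \<subseteq> cylinder_letters h \<and> successively may_precede (a # w @ [b])}"

definition strip_sum :: "'a::comm_ring_1 \<Rightarrow> nat \<Rightarrow> enat \<Rightarrow> nat \<Rightarrow> enat \<Rightarrow> 'a" where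
  "strip_sum t h a m b = (\<Sum>w\<in>strip_words h a m b. t ^ bigtiles w)"

lemma finite_strip_words: "finite (strip_words h a m b)"
  by (rule finite_subset[OF _ finite_lists_length_eq[of "cylinder_letters h" m]])
     (auto simp: strip_words_def)

lemma bigtiles_eq_length_filter: "bigtiles w = length (filter (\<lambda>x. x \<noteq> \<infinity>) w)"
  by (simp only: bigtiles_def length_filter_conv_card)

lemma strip_sum_0: "strip_sum t h a 0 b = (if may_precede a b then 1 else 0)"
proof -
  have "strip_words h a 0 b = (if may_precede a b then {[]} else {})"
    by (auto simp: strip_words_def)
  then show ?thesis by (simp add: strip_sum_def bigtiles_def)
qed

lemma sum_UN_Cons:
  assumes "finite C" "\<And>c. c \<in> C \<Longrightarrow> finite (W c)"
  shows "(\<Sum>w\<in>(\<Union>c\<in>C. (#) c ` W c). t ^ bigtiles w) =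
    (\<Sum>c\<in>C. (if c = \<infinity> then 1 else t) * (\<Sum>w\<in>W c. t ^ bigtiles w :: 'a::comm_ring_1))"
proof -
  have "(\<Sum>w\<in>(\<Union>c\<in>C. (#) c ` W c). t ^ bigtiles w) =
    (\<Sum>c\<in>C. \<Sum>w\<in>(#) c ` W c. t ^ bigtiles w)"
    using assms by (intro sum.UNION_disjoint) auto
  also have "\<dots> = (\<Sum>c\<in>C. \<Sum>w\<in>W c. t ^ bigtiles (c # w))"
    by (simp add: sum.reindex)
  also have "\<dots> = (\<Sum>c\<in>C. (if c = \<infinity> then 1 else t) * (\<Sum>w\<in>W c. t ^ bigtiles w))"
    by (intro sum.cong) (auto simp: bigtiles_eq_length_filter sum_distrib_left)
  finally show ?thesis .
qed

lemma strip_sum_Suc: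
  "strip_sum t h a (Suc m) b =
    (\<Sum>c | c \<in> cylinder_letters h \<and> may_precede a c. (if c = \<infinity> then 1 else t) * strip_sum t h c m b)"
proof -
  have "strip_words h a (Suc m) b =
    (\<Union>c\<in>{c \<in> cylinder_letters h. may_precede a c}. (#) c ` strip_words h c m b)"
  proof (intro equalityI subsetI)
    fix w assume w: "w \<in> strip_words h a (Suc m) b"
    then obtain c v where cv: "w = c # v" by (cases w) (auto simp: strip_words_def)
    with w have "c \<in> {c \<in> cylinder_letters h. may_precede a c}" "v \<in> strip_words h c m b"
      by (simp_all add: strip_words_def)
    then show "w \<in> (\<Union>c\<in>{c \<in> cylinder_letters h. may_precede a c}. (#) c ` strip_words h c m b)"
      unfolding cv by blast
  qed (auto simp: strip_words_def)
  then show ?thesis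
    by (simp add: strip_sum_def sum_UN_Cons finite_strip_words)
qed

lemma strip_sum_top:
  "strip_sum t h (enat h) (Suc m) b = strip_sum t h \<infinity> m b"
proof -
  have "{c \<in> cylinder_letters h. may_precede (enat h) c} = {\<infinity>}"
    by (auto simp: may_precede_def one_enat_def)
  then show ?thesis by (simp only: strip_sum_Suc) simp
qed

text \<open>The next letter is \<open>a + 1\<close>, at cost \<open>t\<close>, or one allowed after
  \<open>a + 1\<close>: the two terms of the tiling recurrence.\<close>

lemma strip_sum_step:
  assumes "a < h"
  shows "strip_sum t h (enat a) (Suc m) b =
    strip_sum t h (enat (Suc a)) (Suc m) b + t * strip_sum t h (enat (Suc a)) m b"
proof -
  have "{c \<in> cylinder_letters h. may_precede (enat a) c} =
    insert (enat (Suc a)) {c \<in> cylinder_letters h. may_precede (enat (Suc a)) c}"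
    using assms by (auto simp: may_precede_def one_enat_def)
  moreover have "\<not> may_precede (enat (Suc a)) (enat (Suc a))"
    by (simp add: may_precede_def one_enat_def)
  ultimately show ?thesis by (simp add: strip_sum_Suc algebra_simps)
qed

text \<open>The fictitious letter 0 imposes no restriction, just like \<open>\<infinity>\<close>.\<close>

lemma strip_sum_infinity:
  assumes "b \<in> cylinder_letters h"
  shows "strip_sum t h \<infinity> m b = strip_sum t h (enat 0) m b"
proof -
  have "may_precede \<infinity> c \<and> may_precede (enat 0) c" if "c \<in> cylinder_letters h" for c
    using that by (auto simp: may_precede_def one_enat_def)
  then have "successively may_precede (\<infinity> # w @ [b]) \<longleftrightarrow> successively may_precede (enat 0 # w @ [b])"
    if "set w \<subseteq> cylinder_letters h" for w
    using assms that by (cases w) simp_all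
  then have "strip_words h \<infinity> m b = strip_words h (enat 0) m b"
    unfolding strip_words_def by blast
  then show ?thesis by (simp add: strip_sum_def)
qed

text \<open>The final letter \<open>b\<close> only shifts the index: \<open>s = b - 1\<close>, or \<open>s = h\<close> for \<open>b = \<infinity>\<close>.\<close>

lemma strip_sum_eq_tilings:
  assumes "i \<le> h" and "b = \<infinity> \<and> s = h \<or> b = enat (Suc s) \<and> s < h"
  shows "strip_sum t h (enat (h - i)) m b = tilings h t (m * h + i + s)"
  using assms(1)
proof (induction m arbitrary: i)
  \<comment> \<open>\<open>h - i\<close> may precede \<open>b\<close> iff
    \<open>h \<le> i + s\<close>, and \<open>i + s \<le> 2 * h\<close>, so \<open>tilings\<close> is
    1 or 0 accordingly.\<close>
  case 0
  then show ?case
    using assms(2) by (auto simp: strip_sum_0 may_precede_def one_enat_def tilings_eq_1)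
next
  case (Suc m)
  have b: "b \<in> cylinder_letters h" using assms(2) by auto
  show ?case using Suc.prems
  proof (induction i)
    \<comment> \<open>Only \<infinity> follows \<open>h\<close>, and it acts like the letter 0: the
      outer hypothesis applies at \<open>i = h\<close>.\<close>
    case 0
    show ?case
      using Suc.IH[of h] by (simp add: strip_sum_top strip_sum_infinity[OF b] algebra_simps)
  next
    case (Suc i)
    have "Suc (h - Suc i) = h - i" using Suc.prems by simp
    then have "strip_sum t h (enat (h - Suc i)) (Suc m) b =
      tilings h t (Suc m * h + i + s) + t * tilings h t (m * h + i + s)"
      \<comment> \<open>The inner hypothesis covers \<open>Suc m\<close> letters, the outer one,
        quoted by its form, \<open>m\<close> letters.\<close>
      using Suc.IH Suc.prems \<open>\<And>i. i \<le> h \<Longrightarrow> _\<close> by (simp add: strip_sum_step)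
    also have "\<dots> = tilings h t (Suc m * h + Suc i + s)"
      using tilings_Suc[of h "Suc m * h + i + s" t] by (simp add: algebra_simps)
    finally show ?case .
  qed
qed

section \<open>Closing words into cycles\<close>

lemma Cons_in_cylinder_words:
  "a # w \<in> cylinder_words h (Suc m) \<longleftrightarrow> a \<in> cylinder_letters h \<and> w \<in> strip_words h a m a"
proof (cases "length w = m")
  case True
  \<comment> \<open>The appended copy of \<open>a\<close> replaces the wrap-around to position 0 at
    \<open>i = m\<close>.\<close>
  have "((a # w) ! i \<noteq> \<infinity> \<longrightarrow> (a # w) ! i + 1 \<le> (a # w) ! ((i + 1) mod Suc m)) \<longleftrightarrow>
    may_precede ((a # w @ [a]) ! i) ((a # w @ [a]) ! Suc i)" if "i < Suc m" for i
    using that True by (cases "i = m") (auto simp: may_precede_def nth_append nth_Cons')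
  then show ?thesis
    using True by (auto simp: cylinder_words_def strip_words_def successively_conv_nth)
qed (auto simp: cylinder_words_def strip_words_def)

lemma cylinder_words_Suc:
  "cylinder_words h (Suc m) = (\<Union>a\<in>cylinder_letters h. (#) a ` strip_words h a m a)"
proof (intro equalityI subsetI)
  fix w assume w: "w \<in> cylinder_words h (Suc m)"
  then obtain a v where av: "w = a # v"
    by (cases w) (simp_all add: cylinder_words_def)
  with w have "a \<in> cylinder_letters h" "v \<in> strip_words h a m a"
    by (simp_all only: Cons_in_cylinder_words)
  then show "w \<in> (\<Union>a\<in>cylinder_letters h. (#) a ` strip_words h a m a)"
    unfolding av by (intro UN_I[where a = a] imageI)
next
  fix w assume "w \<in> (\<Union>a\<in>cylinder_letters h. (#) a ` strip_words h a m a)"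
  then show "w \<in> cylinder_words h (Suc m)"
    by (elim UN_E imageE) (simp only: Cons_in_cylinder_words)
qed

lemma sum_cylinder_words:
  assumes "1 \<le> h"
  shows "(\<Sum>w\<in>cylinder_words h (Suc m). t ^ bigtiles w) =
    tilings h t ((m + 2) * h - 1) + of_nat (Suc h) * t * tilings h t ((m + 2) * h - 1 - h)"
proof -
  \<comment> \<open>Here \<open>i = h - a\<close> and \<open>s = a - 1\<close>, so
    \<open>i + s = h - 1\<close> for each of the \<open>h\<close> finite letters.\<close>
  have finite_part: "strip_sum t h (enat a) m (enat a) = tilings h t ((m + 1) * h - 1)"
    if "a \<in> {1..h}" for a
  proof -
    have "a - 1 < h" using that by auto
    then show ?thesis
      using that strip_sum_eq_tilings[of "h - a" h "enat a" "a - 1" t m] by (simp add: add.commute)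
  qed
  have "(\<Sum>w\<in>cylinder_words h (Suc m). t ^ bigtiles w) =
    (\<Sum>a\<in>cylinder_letters h. (if a = \<infinity> then 1 else t) * strip_sum t h a m a)"
    by (simp only: cylinder_words_Suc strip_sum_def sum_UN_Cons finite_strip_words finite_insert
        finite_imageI finite_atLeastAtMost)
  also have "\<dots> = strip_sum t h \<infinity> m \<infinity> + (\<Sum>a=1..h. t * strip_sum t h (enat a) m (enat a))"
    by (subst sum.insert) (auto simp: sum.reindex inj_on_def)
  also have "(\<Sum>a=1..h. t * strip_sum t h (enat a) m (enat a)) =
    of_nat h * t * tilings h t ((m + 1) * h - 1)"
    using finite_part by simp
  also have "strip_sum t h \<infinity> m \<infinity> = tilings h t (Suc ((m + 2) * h - 1))"
    using strip_sum_eq_tilings[of h h \<infinity> h t m] assms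
    by (simp add: strip_sum_infinity algebra_simps)
  \<comment> \<open>One unfolding of the recurrence raises the factor \<open>h\<close> from the
    finite letters to \<open>h + 1\<close>.\<close>
  also have "\<dots> = tilings h t ((m + 2) * h - 1) + t * tilings h t ((m + 2) * h - 1 - h)"
    using assms by (intro tilings_Suc) simp
  also have "(m + 1) * h - 1 = (m + 2) * h - 1 - h" by simp
  finally show ?thesis by (simp add: algebra_simps)
qed

section \<open>Real zeros\<close>

lemma poly_cylinder_poly:
  "poly (map_poly complex_of_real (cylinder_poly h n)) z = (\<Sum>w\<in>cylinder_words h n. z ^ bigtiles w)"
proof -
  have "map_poly complex_of_real (cylinder_poly h n) = (\<Sum>w\<in>cylinder_words h n. monom 1 (bigtiles w))"
    by (rule poly_eqI) (simp add: cylinder_poly_def coeff_map_poly coeff_sum if_distrib[of complex_of_real] cong: if_cong)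
  then show ?thesis by (simp add: poly_sum poly_monom)
qed

theorem theorem6p5:
  fixes h n :: nat
  assumes "h \<ge> 1" and "n \<ge> 1"
  shows "only_real_zeros (cylinder_poly h n)"
proof -
  define f where "f z = (\<Sum>w\<in>cylinder_words h n. z ^ bigtiles w)" for z :: complex
  obtain m where n: "n = Suc m" using assms(2) by (cases n) auto
  have nonzero: "f z \<noteq> 0" if "0 < Im z" for z
  proof -
    have "h \<le> (m + 2) * h - 1" using assms(1) by simp
    then show ?thesis
      using tilings_add_mult_nonzero[of z "real (Suc h)" h "(m + 2) * h - 1"]
        tilings_nonzero[of z h "(m + 2) * h - 1"] that
      unfolding f_def n sum_cylinder_words[OF assms(1)] by simp
  qed
  have "z \<in> \<real>" if "f z = 0" for z
  proof -
    \<comment> \<open>Real coefficients: a zero in the lower half plane would give one in the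
      upper.\<close>
    have "f (cnj z) = cnj (f z)" by (simp add: f_def)
    then have "\<not> 0 < Im z" "\<not> 0 < Im (cnj z)"
      using nonzero[of z] nonzero[of "cnj z"] that by auto
    then show ?thesis by (simp add: complex_is_Real_iff)
  qed
  then show ?thesis by (simp add: only_real_zeros_def poly_cylinder_poly f_def)
qed

end
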